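(* Let $\mathbb{F}$ be a totally ordered division ring and let $(T,\trianglelefteq,\sim)$ be a colored tree. The relation $\equiv$ is an equivalence relation on $\mathbb{F}^{(T)}_+$.
   Context: A tree is a poset $(T,\trianglelefteq)$ such that $\{q\in T\mid q\trianglelefteq p\}$ is a finite chain for every $p\in T$. Write $p\prec q$ if $p$ is a lower cover of $q$; every non-minimal $q$ has a unique lower cover, denoted $q_*$. A coloring of $T$ is an equivalence relation $\sim$ on $T$ such that (1) the $\sim$-class $[p]$ of every non-minimal $p$ is finite with at least two elements; (2) if $p\sim q$, then either both $p,q$ are minimal or $p_*=q_*$. A colored tree is a triple $(T,\trianglelefteq,\sim)$ with $\sim$ a coloring of the tree $(T,\trianglelefteq)$. Put $\mathcal{M}_T=\{(p,[q])\mid p,q\in T,\ p\prec q\}$. Let $\mathbb{F}^{(T)}$ be the free left $\mathbb{F}$-vector space of finitely supported maps $T\to\mathbb{F}$, with canonical basis $(\dot p)_{p\in T}$, and $\mathbb{F}^{(T)}_+=\{x\in\mathbb{F}^{(T)}\mid x(p)\geq0\text{ for all }p\in T\}$. For $x,y\in\mathbb{F}^{(T)}_+$, write $x\longrightarrow^{1}y$ if there are $(p,I)\in\mathcal{M}_T$, $\lambda\geq0$ in $\mathbb{F}$ and $z\in\mathbb{F}^{(T)}_+$ with $x=\frac{\lambda}{|I|}\sum_{q\in I}\dot q+z$ and $y=\lambda\dot p+z$. Let $x\longrightarrow^{0}y$ mean $x=y$, let $x\longrightarrow^{n+1}y$ mean that $x\longrightarrow^{1}z\longrightarrow^{n}y$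 for some $z\in\mathbb{F}^{(T)}_+$, and let $x\longrightarrow^{*}y$ mean $x\longrightarrow^{n}y$ for some natural number $n$. Write $x\equiv y$ if there exists $u\in\mathbb{F}^{(T)}_+$ with $x\longrightarrow^{*}u$ and $y\longrightarrow^{*}u$. *)

theory Defs
  imports "HOL-Library.Poly_Mapping"
begin

definition tree :: "'a set \<Rightarrow> 'a rel \<Rightarrow> bool" where
  "tree T le \<longleftrightarrow> partial_order_on T le \<and>
     (\<forall>p\<in>T. finite {q\<in>T. (q, p) \<in> le} \<and> {q\<in>T. (q, p) \<in> le} \<in> Chains le)"

definition covers :: "'a set \<Rightarrow> 'a rel \<Rightarrow> 'a \<Rightarrow> 'a \<Rightarrow> bool" where
  "covers T le p q \<longleftrightarrow> p \<in> T \<and> q \<in> T \<and> (p, q) \<in> le \<and> p \<noteq> q \<and>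
     \<not> (\<exists>r\<in>T. (p, r) \<in> le \<and> (r, q) \<in> le \<and> r \<noteq> p \<and> r \<noteq> q)"

definition minimal :: "'a set \<Rightarrow> 'a rel \<Rightarrow> 'a \<Rightarrow> bool" where
  "minimal T le p \<longleftrightarrow> p \<in> T \<and> (\<forall>q\<in>T. (q, p) \<in> le \<longrightarrow> q = p)"

text \<open>Only meaningful for a non-minimal element of a tree, where the lower cover exists
  and is unique.\<close>

definition lower_cover :: "'a set \<Rightarrow> 'a rel \<Rightarrow> 'a \<Rightarrow> 'a" where
  "lower_cover T le q = (THE p. covers T le p q)"

text \<open>Writing \<open>p\<^sub>* = q\<^sub>*\<close> presupposes that both \<open>p\<close> and \<open>q\<close> are non-minimal; since
  \<^const>\<open>lower_cover\<close> is a total function, this has to be said explicitly.\<close>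

definition coloring :: "'a set \<Rightarrow> 'a rel \<Rightarrow> 'a rel \<Rightarrow> bool" where
  "coloring T le col \<longleftrightarrow> equiv T col \<and>
     (\<forall>p\<in>T. \<not> minimal T le p \<longrightarrow> finite (col `` {p}) \<and> 2 \<le> card (col `` {p})) \<and>
     (\<forall>(p, q)\<in>col. minimal T le p \<and> minimal T le q \<or>
        \<not> minimal T le p \<and> \<not> minimal T le q \<and> lower_cover T le p = lower_cover T le q)"

definition colored_tree :: "'a set \<Rightarrow> 'a rel \<Rightarrow> 'a rel \<Rightarrow> bool" where
  "colored_tree T le col \<longleftrightarrow> tree T le \<and> coloring T le col"

definition MT :: "'a set \<Rightarrow> 'a rel \<Rightarrow> 'a rel \<Rightarrow> ('a \<times> 'a set) set" where
  "MT T le col = {(p, col `` {q}) | p q. p \<in> T \<and> q \<in> T \<and> covers T le p q}"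

text \<open>A totally ordered division ring, not necessarily commutative, is a type of sort
  \<open>{division_ring, linordered_ring_strict}\<close>. The maps from \<open>T\<close> with finite support are the
  finitely supported maps on the ambient type whose support is contained in \<open>T\<close>.\<close>

definition Fpos :: "'a set \<Rightarrow> ('a \<Rightarrow>\<^sub>0 'f::{division_ring,linordered_ring_strict}) set" where
  "Fpos T = {x. Poly_Mapping.keys x \<subseteq> T \<and> (\<forall>p\<in>T. 0 \<le> Poly_Mapping.lookup x p)}"

definition scale ::
  "'f::{division_ring,linordered_ring_strict} \<Rightarrow> ('a \<Rightarrow>\<^sub>0 'f) \<Rightarrow> ('a \<Rightarrow>\<^sub>0 'f)" where
  "scale c x = Poly_Mapping.map (\<lambda>a. c * a) x"

lemma lookup_scale [simp]: "Poly_Mapping.lookup (scale c x) p = c * Poly_Mapping.lookup x p"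
  by (simp add: scale_def Poly_Mapping.map.rep_eq when_def)

definition dot :: "'a \<Rightarrow> ('a \<Rightarrow>\<^sub>0 'f::{division_ring,linordered_ring_strict})" where
  "dot p = Poly_Mapping.single p 1"

definition step1 :: "'a set \<Rightarrow> 'a rel \<Rightarrow> 'a rel \<Rightarrow>
    ('a \<Rightarrow>\<^sub>0 'f::{division_ring,linordered_ring_strict}) \<Rightarrow> ('a \<Rightarrow>\<^sub>0 'f) \<Rightarrow> bool" where
  "step1 T le col x y \<longleftrightarrow> x \<in> Fpos T \<and> y \<in> Fpos T \<and>
     (\<exists>(p, I)\<in>MT T le col. \<exists>l\<ge>0. \<exists>z\<in>Fpos T.
        x = scale (l / of_nat (card I)) (\<Sum>q\<in>I. dot q) + z \<and> y = scale l (dot p) + z)"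

primrec steps :: "'a set \<Rightarrow> 'a rel \<Rightarrow> 'a rel \<Rightarrow> nat \<Rightarrow>
    ('a \<Rightarrow>\<^sub>0 'f::{division_ring,linordered_ring_strict}) \<Rightarrow> ('a \<Rightarrow>\<^sub>0 'f) \<Rightarrow> bool" where
  "steps T le col 0 x y \<longleftrightarrow> x = y"
| "steps T le col (Suc n) x y \<longleftrightarrow> (\<exists>z\<in>Fpos T. step1 T le col x z \<and> steps T le col n z y)"

definition reduces :: "'a set \<Rightarrow> 'a rel \<Rightarrow> 'a rel \<Rightarrow>
    ('a \<Rightarrow>\<^sub>0 'f::{division_ring,linordered_ring_strict}) \<Rightarrow> ('a \<Rightarrow>\<^sub>0 'f) \<Rightarrow> bool" where
  "reduces T le col x y \<longleftrightarrow> (\<exists>n. steps T le col n x y)"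

definition equiv_rel :: "'a set \<Rightarrow> 'a rel \<Rightarrow> 'a rel \<Rightarrow>
    ('a \<Rightarrow>\<^sub>0 'f::{division_ring,linordered_ring_strict}) rel" where
  "equiv_rel T le col = {(x, y). x \<in> Fpos T \<and> y \<in> Fpos T \<and>
     (\<exists>u\<in>Fpos T. reduces T le col x u \<and> reduces T le col y u)}"

end

theory Submission
  imports Defs "HOL-Library.Confluence"
begin

text \<open>
  Reflexivity and symmetry of \<open>\<equiv>\<close> are immediate; transitivity is the confluence of
  \<open>\<longrightarrow>\<^sup>1\<close>. A single step can be described without the remainder \<open>z\<close>: it picks
  \<open>(p, I)\<close> in \<^const>\<open>MT\<close> and an amount \<open>m \<ge> 0\<close> that every entry of \<open>x\<close> at \<open>I\<close> can afford, and
  adds to \<open>x\<close> the vector \<open>m (|I| p - \<Sum>I)\<close>. Such moves are translations, so they commute, and the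
  only question is whether each of two competing moves is still affordable after the other.
  If the color classes differ, they are disjoint, and the first move cannot lower any entry in the
  class of the second. If the classes are equal, then so are the targets, because color classes lie
  over a single lower cover; the two moves then differ only in their amounts, and the smaller one can
  be topped up to the larger. Hence \<open>\<longrightarrow>\<^sup>1\<close> has the diamond property, which gives
  confluence.
\<close>

section \<open>Covers and color classes\<close>

text \<open>Two lower covers of \<open>q\<close> are comparable because the elements below \<open>q\<close> form a chain, and
  neither can lie strictly between the other and \<open>q\<close>.\<close>

lemma covers_unique:
  assumes "tree T le" "covers T le p q" "covers T le p' q"
  shows "p = p'"
proof -
  have "{r\<in>T. (r, q) \<in> le} \<in> Chains le"
    using assms by (auto simp: tree_def covers_def)
  then have "(p, p') \<in> le \<or> (p', p) \<in> le"
    using assms(2,3) by (auto simp: Chains_def covers_def)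
  then show ?thesis
    using assms(2,3) unfolding covers_def by blast
qed

lemma lower_cover_eq:
  assumes "tree T le" "covers T le p q"
  shows "lower_cover T le q = p"
  unfolding lower_cover_def
  using assms(2) covers_unique[OF assms(1) _ assms(2)] by (rule the_equality)

lemma covers_not_minimal: "covers T le p q \<Longrightarrow> \<not> minimal T le q"
  by (auto simp: covers_def minimal_def)

lemma MT_finite_class:
  assumes "colored_tree T le col" "(p, I) \<in> MT T le col"
  shows "finite I" "card I \<noteq> 0"
proof -
  obtain q where q: "covers T le p q" "q \<in> T" "I = col `` {q}"
    using assms(2) by (auto simp: MT_def)
  then have "finite I \<and> 2 \<le> card I"
    using assms(1) covers_not_minimal[OF q(1)] by (simp add: colored_tree_def coloring_def)
  then show "finite I" "card I \<noteq> 0" by auto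
qed

lemma MT_subset:
  assumes "colored_tree T le col" "(p, I) \<in> MT T le col"
  shows "p \<in> T" "I \<subseteq> T"
  using assms by (auto simp: MT_def colored_tree_def coloring_def equiv_def refl_on_def)

lemma MT_disjoint:
  assumes "colored_tree T le col" "(p, I) \<in> MT T le col" "(p', I') \<in> MT T le col" "I \<noteq> I'"
  shows "I \<inter> I' = {}"
proof -
  have eq: "equiv T col"
    using assms(1) by (simp add: colored_tree_def coloring_def)
  have "I \<in> T // col" "I' \<in> T // col"
    using assms(2,3) by (auto simp: MT_def intro: quotientI)
  then show ?thesis
    using quotient_disj[OF eq] assms(4) by blast
qed

text \<open>Condition (2) on colorings makes all members of a class of non-minimal elements share their
  lower cover. So a class determines the point that a step on it feeds.\<close>

lemma MT_target_unique:
  assumes "colored_tree T le col" "(p, I) \<in> MT T le col" "(p', I) \<in> MT T le col"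
  shows "p = p'"
proof -
  have tree: "tree T le" and eq: "equiv T col"
    using assms(1) by (auto simp: colored_tree_def coloring_def)
  obtain q where q: "covers T le p q" "I = col `` {q}" "q \<in> T"
    using assms(2) by (auto simp: MT_def)
  obtain q' where q': "covers T le p' q'" "I = col `` {q'}" "q' \<in> T"
    using assms(3) by (auto simp: MT_def)
  have "(q, q') \<in> col"
    using eq_equiv_class[OF _ eq, of q q'] q q' by simp
  then have "lower_cover T le q = lower_cover T le q'"
    using assms(1) covers_not_minimal[OF q(1)] by (auto simp: colored_tree_def coloring_def)
  then show ?thesis
    using lower_cover_eq[OF tree] q(1) q'(1) by simp
qed

section \<open>Natural numbers in an ordered division ring\<close>

text \<open>The order axioms of the sort say nothing about \<open>1\<close>, which is positive as a nonzero square.\<close>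

lemma of_nat_ordered_ring_pos:
  "0 < n \<Longrightarrow> (0::'f::{division_ring,linordered_ring_strict}) < of_nat n"
proof -
  have one: "(0::'f) < 1"
    using zero_le_square[of "1::'f"] by (simp add: order.strict_iff_order)
  have pos: "(0::'f) < of_nat (Suc k)" for k
  proof (induction k)
    case (Suc k)
    then show ?case
      using add_pos_pos[OF one] by (simp only: of_nat_Suc[of "Suc k"])
  qed (simp add: one)
  show "0 < n \<Longrightarrow> (0::'f) < of_nat n"
    using pos[of "n - 1"] by simp
qed

lemma of_nat_ordered_ring_nonneg: "(0::'f::{division_ring,linordered_ring_strict}) \<le> of_nat n"
proof (cases "n = 0")
  case False
  then show ?thesis
    using less_imp_le[OF of_nat_ordered_ring_pos[of n]] by blast
qed simp

section \<open>Steps as translations\<close>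

lemma scale_add_left: "scale (a + b) x = scale a x + scale b x"
  by (rule poly_mapping_eqI) (simp add: lookup_add distrib_right)

lemma lookup_dot: "Poly_Mapping.lookup (dot p) r = (if r = p then 1 else 0)"
  by (auto simp: dot_def lookup_single)

lemma lookup_sum_dot:
  "finite I \<Longrightarrow> Poly_Mapping.lookup (\<Sum>q\<in>I. dot q) r = (if r \<in> I then 1 else 0)"
  by (induction I rule: finite_induct)
    (auto simp: lookup_add lookup_dot)

text \<open>The change to a vector caused by the step along \<open>(p, I)\<close> that takes one unit from each member
  of \<open>I\<close>. A step with parameter \<open>\<lambda>\<close> changes a vector by \<open>\<lambda> / |I|\<close> times this: the amount taken from each
  member, rather than \<open>\<lambda>\<close>, is what competing steps are compared by.\<close>

definition exchange :: "'a \<Rightarrow> 'a set \<Rightarrow> ('a \<Rightarrow>\<^sub>0 'f::{division_ring,linordered_ring_strict})" where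
  "exchange p I = scale (of_nat (card I)) (dot p) - (\<Sum>q\<in>I. dot q)"

lemma lookup_exchange:
  "finite I \<Longrightarrow> Poly_Mapping.lookup (exchange p I) r =
     (if r = p then of_nat (card I) else 0) - (if r \<in> I then 1 else 0)"
  by (simp add: exchange_def lookup_minus lookup_sum_dot lookup_dot)

text \<open>A step by \<open>m\<close> lowers an entry by at most \<open>m\<close>, and only inside its own class: the unit taken from
  each member of \<open>I\<close> is the only negative contribution, even if \<open>p\<close> were to lie in \<open>I\<close>.\<close>

lemma exchange_ge:
  fixes m :: "'f::{division_ring,linordered_ring_strict}"
  assumes "finite I" "0 \<le> m"
  shows "- m \<le> m * Poly_Mapping.lookup (exchange p I) r"
    and "r \<notin> I \<Longrightarrow> 0 \<le> m * Poly_Mapping.lookup (exchange p I) r"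
proof -
  show "r \<notin> I \<Longrightarrow> 0 \<le> m * Poly_Mapping.lookup (exchange p I) r"
    using assms of_nat_ordered_ring_nonneg[where ?'f='f, of "card I"] by (simp add: lookup_exchange)
  have "- m \<le> 0"
    using assms(2) by simp
  moreover have "0 \<le> m * (if r = p then of_nat (card I) else 0)"
    using assms(2) of_nat_ordered_ring_nonneg[where ?'f='f, of "card I"] by simp
  ultimately show "- m \<le> m * Poly_Mapping.lookup (exchange p I) r"
    using assms order_trans[of "- m" 0 "m * of_nat (card I)"]
    by (auto simp: lookup_exchange right_diff_distrib split: if_splits)
qed

lemma Fpos_iff:
  "x \<in> Fpos T \<longleftrightarrow>
     (\<forall>r\<in>T. 0 \<le> Poly_Mapping.lookup x r) \<and> (\<forall>r. r \<notin> T \<longrightarrow> Poly_Mapping.lookup x r = 0)"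
  by (auto simp: Fpos_def in_keys_iff)

text \<open>The remainder \<open>z\<close> only expresses that the entries of \<open>x\<close> at \<open>I\<close> are at least \<open>m\<close>. Scaling acts
  from the left, and \<open>m\<close> stands to the left of \<open>|I|\<close> throughout, so that \<open>m |I| = \<lambda>\<close> for
  \<open>m = \<lambda> / |I|\<close> without any commutativity of the scalars.\<close>

lemma step1_iff:
  fixes x y :: "'a \<Rightarrow>\<^sub>0 'f::{division_ring,linordered_ring_strict}"
  assumes ct: "colored_tree T le col"
  shows "step1 T le col x y \<longleftrightarrow> x \<in> Fpos T \<and>
    (\<exists>p I m. (p, I) \<in> MT T le col \<and> 0 \<le> m \<and> (\<forall>r\<in>I. m \<le> Poly_Mapping.lookup x r) \<and>
       y = x + scale m (exchange p I))"
    (is "_ \<longleftrightarrow> _ \<and> (\<exists>p I m. ?move p I m)")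
proof safe
  assume step: "step1 T le col x y"
  then show "x \<in> Fpos T" by (simp add: step1_def)
  from step obtain p I l z where MT: "(p, I) \<in> MT T le col" and l: "0 \<le> l" and z: "z \<in> Fpos T"
    and x: "x = scale (l / of_nat (card I)) (\<Sum>q\<in>I. dot q) + z" and y: "y = scale l (dot p) + z"
    by (auto simp: step1_def)
  note I = MT_finite_class[OF ct MT] and sub = MT_subset[OF ct MT]
  have n: "(0::'f) < of_nat (card I)"
    using I(2) of_nat_ordered_ring_pos by blast
  define m where "m = l / of_nat (card I)"
  have ml: "m * of_nat (card I) = l"
    using n by (simp add: m_def flip: nonzero_eq_divide_eq)
  have m: "0 \<le> m"
  proof (rule ccontr)
    assume "\<not> 0 \<le> m"
    then have "m * of_nat (card I) < 0"
      using n by (simp add: mult_neg_pos)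
    then show False using ml l by simp
  qed
  have "\<forall>r\<in>I. m \<le> Poly_Mapping.lookup x r"
    using z sub I(1) by (auto simp: x lookup_add lookup_sum_dot Fpos_iff m_def[symmetric])
  moreover have "y = x + scale m (exchange p I)"
    using I(1) ml
    by (intro poly_mapping_eqI)
      (auto simp: x y lookup_add lookup_sum_dot lookup_exchange lookup_dot
        m_def[symmetric] right_diff_distrib)
  ultimately show "\<exists>p I m. ?move p I m"
    using MT m by blast
next
  fix p I and m :: 'f
  assume x: "x \<in> Fpos T" and MT: "(p, I) \<in> MT T le col" and m: "0 \<le> m"
    and le: "\<forall>r\<in>I. m \<le> Poly_Mapping.lookup x r"
  note I = MT_finite_class[OF ct MT] and sub = MT_subset[OF ct MT]
  have n: "(0::'f) < of_nat (card I)"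
    using I(2) of_nat_ordered_ring_pos by blast
  define z where "z = x - scale m (\<Sum>q\<in>I. dot q)"
  define l where "l = m * of_nat (card I)"
  have l: "0 \<le> l" "l / of_nat (card I) = m"
    using m n nonzero_eq_divide_eq[of "of_nat (card I)" m "m * of_nat (card I)"]
    by (auto simp: l_def intro: mult_nonneg_nonneg)
  have z: "z \<in> Fpos T"
    using x le sub I(1) by (auto simp: z_def Fpos_iff lookup_minus lookup_sum_dot)
  have y: "x + scale m (exchange p I) = scale l (dot p) + z"
    by (intro poly_mapping_eqI)
      (simp add: z_def l_def exchange_def lookup_add lookup_minus right_diff_distrib mult.assoc)
  have "scale l (dot p) + z \<in> Fpos T"
    using z l sub by (auto simp: Fpos_iff lookup_add lookup_dot)
  then show "step1 T le col x (x + scale m (exchange p I))"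
    unfolding step1_def y using x MT l z
    by (auto simp: z_def intro!: bexI[of _ "(p, I)"] exI[of _ l] bexI[of _ z])
qed

section \<open>Confluence\<close>

text \<open>After a move by \<open>m\<close>, each entry at \<open>I\<close> is still at least \<open>m' - m\<close>, so the move by \<open>m'\<close> can be
  completed by a second move along the same \<open>(p, I)\<close>.\<close>

lemma step1_top_up_same_class:
  fixes x :: "'a \<Rightarrow>\<^sub>0 'f::{division_ring,linordered_ring_strict}"
  assumes ct: "colored_tree T le col" and MT: "(p, I) \<in> MT T le col"
    and y: "x + scale m (exchange p I) \<in> Fpos T"
    and m: "m \<le> m'" "0 \<le> m" and le: "\<forall>r\<in>I. m' \<le> Poly_Mapping.lookup x r"
  shows "step1 T le col (x + scale m (exchange p I)) (x + scale m' (exchange p I))"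
proof -
  have "m' - m \<le> Poly_Mapping.lookup (x + scale m (exchange p I)) r" if "r \<in> I" for r
  proof -
    have "- m \<le> m * Poly_Mapping.lookup (exchange p I) r"
      using exchange_ge(1) MT_finite_class(1)[OF ct MT] m(2) .
    then show ?thesis
      using add_mono[of m' "Poly_Mapping.lookup x r" "- m"] le that by (simp add: lookup_add)
  qed
  moreover have "x + scale m' (exchange p I) =
      x + scale m (exchange p I) + scale (m' - m) (exchange p I)"
    using scale_add_left[of m "m' - m" "exchange p I"] by (simp add: add.assoc)
  ultimately show ?thesis
    using y MT m(1) unfolding step1_iff[OF ct]
    by (intro conjI exI[of _ p] exI[of _ I] exI[of _ "m' - m"]) auto
qed

text \<open>The entries at \<open>I'\<close> can only have grown (one of them may be \<open>p\<close>), so the move along \<open>(p', I')\<close>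
  remains possible.\<close>

lemma step1_after_disjoint:
  fixes x :: "'a \<Rightarrow>\<^sub>0 'f::{division_ring,linordered_ring_strict}"
  assumes ct: "colored_tree T le col" and MT: "(p, I) \<in> MT T le col" "(p', I') \<in> MT T le col"
    and disj: "I \<inter> I' = {}" and y: "x + scale m (exchange p I) \<in> Fpos T"
    and m: "0 \<le> m" "0 \<le> m'" and le: "\<forall>r\<in>I'. m' \<le> Poly_Mapping.lookup x r"
  shows "step1 T le col (x + scale m (exchange p I))
    (x + scale m (exchange p I) + scale m' (exchange p' I'))"
proof -
  have "m' \<le> Poly_Mapping.lookup (x + scale m (exchange p I)) r" if "r \<in> I'" for r
  proof -
    have "r \<notin> I" using disj that by blast
    then have "0 \<le> m * Poly_Mapping.lookup (exchange p I) r"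
      by (rule exchange_ge(2)[OF MT_finite_class(1)[OF ct MT(1)] m(1)])
    then show ?thesis
      using le that by (simp add: lookup_add add_increasing2)
  qed
  then show ?thesis
    using y MT m unfolding step1_iff[OF ct]
    by (intro conjI exI[of _ p'] exI[of _ I'] exI[of _ m']) auto
qed

text \<open>A common successor is reached in at most one step from either side. This is weakened here to the
  asymmetric form that defines strong confluence.\<close>

lemma step1_diamond:
  fixes x y z :: "'a \<Rightarrow>\<^sub>0 'f::{division_ring,linordered_ring_strict}"
  assumes ct: "colored_tree T le col" and xy: "step1 T le col x y" and xz: "step1 T le col x z"
  shows "\<exists>u. (step1 T le col)\<^sup>*\<^sup>* y u \<and> (step1 T le col)\<^sup>=\<^sup>= z u"
proof -
  have Fpos: "y \<in> Fpos T" "z \<in> Fpos T"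
    using xy xz by (auto simp: step1_def)
  obtain p I m where y: "(p, I) \<in> MT T le col" "0 \<le> m" "\<forall>r\<in>I. m \<le> Poly_Mapping.lookup x r"
    "y = x + scale m (exchange p I)"
    using xy unfolding step1_iff[OF ct] by blast
  obtain p' I' m' where z: "(p', I') \<in> MT T le col" "0 \<le> m'" "\<forall>r\<in>I'. m' \<le> Poly_Mapping.lookup x r"
    "z = x + scale m' (exchange p' I')"
    using xz unfolding step1_iff[OF ct] by blast
  show ?thesis
  proof (cases "I = I'")
    case True
    with y(1) z(1) have "p = p'"
      using MT_target_unique[OF ct] by blast
    have "step1 T le col y z \<or> step1 T le col z y"
    proof (cases "m \<le> m'")
      case True
      then show ?thesis
        using step1_top_up_same_class[OF ct y(1), of x m m'] \<open>I = I'\<close> \<open>p = p'\<close> y z Fpos by simp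
    next
      case False
      then show ?thesis
        using step1_top_up_same_class[OF ct y(1), of x m' m] \<open>I = I'\<close> \<open>p = p'\<close> y z Fpos by simp
    qed
    then show ?thesis
    proof
      assume "step1 T le col y z"
      then have "(step1 T le col)\<^sup>*\<^sup>* y z" by (rule r_into_rtranclp)
      then show ?thesis by (intro exI[of _ z]) simp
    next
      assume "step1 T le col z y"
      then show ?thesis by (intro exI[of _ y]) simp
    qed
  next
    case False
    then have disj: "I \<inter> I' = {}"
      using MT_disjoint[OF ct y(1) z(1)] by blast
    define u where "u = x + scale m (exchange p I) + scale m' (exchange p' I')"
    have "step1 T le col y u"
      using step1_after_disjoint[OF ct y(1) z(1) disj] y z Fpos by (simp add: u_def)
    moreover have "step1 T le col z u"
      using step1_after_disjoint[OF ct z(1) y(1), of x m' m] disj y z Fpos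
      by (simp add: u_def Int_commute ac_simps)
    ultimately show ?thesis
      by (intro exI[of _ u]) (simp add: r_into_rtranclp)
  qed
qed

lemma step1_Fpos: "step1 T le col x y \<Longrightarrow> y \<in> Fpos T"
  by (simp add: step1_def)

lemma steps_iff_relpowp:
  "steps T le col n x y \<longleftrightarrow> (step1 T le col ^^ n) x y"
proof (induction n arbitrary: x)
  case (Suc n)
  have "(step1 T le col ^^ Suc n) x y \<longleftrightarrow> (\<exists>z. step1 T le col x z \<and> (step1 T le col ^^ n) z y)"
    using relpowp_Suc_D2[of n "step1 T le col" x y] relpowp_Suc_I2[of "step1 T le col" x _ n y]
    by blast
  then show ?case
    using Suc.IH by (auto dest: step1_Fpos simp del: relpowp.simps)
qed auto

lemma reduces_iff_rtranclp: "reduces T le col = (step1 T le col)\<^sup>*\<^sup>*"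
  by (simp add: fun_eq_iff reduces_def steps_iff_relpowp rtranclp_power)

lemma reduces_confluent:
  assumes "colored_tree T le col" "reduces T le col x y" "reduces T le col x z"
  shows "\<exists>u. reduces T le col y u \<and> reduces T le col z u"
proof -
  have "confluentp (step1 T le col)"
    using step1_diamond[OF assms(1)]
    by (intro strong_confluentp_imp_confluentp strong_confluentpI)
  then show ?thesis
    using assms(2,3) unfolding reduces_iff_rtranclp by (auto dest: confluentpD)
qed

lemma reduces_Fpos: "reduces T le col x y \<Longrightarrow> x \<in> Fpos T \<Longrightarrow> y \<in> Fpos T"
  unfolding reduces_iff_rtranclp by (induction rule: rtranclp_induct) (auto simp: step1_Fpos)

theorem proposition5p4:
  fixes T :: "'a set" and le col :: "'a rel"
  assumes "colored_tree T le col"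
  shows "equiv (Fpos T)
    (equiv_rel T le col :: ('a \<Rightarrow>\<^sub>0 'f::{division_ring,linordered_ring_strict}) rel)"
proof (rule equivI)
  let ?E = "equiv_rel T le col :: ('a \<Rightarrow>\<^sub>0 'f) rel"
  show "?E \<subseteq> Fpos T \<times> Fpos T" "sym ?E"
    by (auto simp: equiv_rel_def sym_def)
  show "refl_on (Fpos T) ?E"
    by (auto simp: equiv_rel_def refl_on_def reduces_iff_rtranclp)
  show "trans ?E"
  proof (rule transI)
    fix x y z
    assume "(x, y) \<in> ?E" "(y, z) \<in> ?E"
    then obtain u v where x: "x \<in> Fpos T" and z: "z \<in> Fpos T"
      and u: "reduces T le col x u" "reduces T le col y u"
      and v: "reduces T le col y v" "reduces T le col z v"
      by (auto simp: equiv_rel_def)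
    obtain w where w: "reduces T le col u w" "reduces T le col v w"
      using reduces_confluent[OF assms u(2) v(1)] by blast
    have "reduces T le col x w" "reduces T le col z w"
      using u v w by (auto simp: reduces_iff_rtranclp)
    then show "(x, z) \<in> ?E"
      using x z reduces_Fpos[of T le col x w] by (auto simp: equiv_rel_def)
  qed
qed

end
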